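(* Let $H=(V,E)$ be a 2-colorable hypergraph with at least one edge. Then $\operatorname{ch}(H)\le \lceil L(H)\rceil+1$, where \[ L(H)=\max_{\emptyset\neq E'\subset E}\frac{|E'|}{\left|\bigcup_{e\in E'}e\right|}. \]
   Context: A hypergraph is a pair $H=(V,E)$ with $V$ finite and $E\subset 2^V$. A coloring is proper if every edge contains two vertices of different colors; $H$ is 2-colorable if it has a proper coloring with 2 colors. $H$ is $k$-choosable if for every assignment of lists $L(v)$ of colors with $|L(v)|=k$ for all $v\in V$ there is a proper coloring assigning to each $v$ a color from $L(v)$. The list chromatic number $\operatorname{ch}(H)$ is the minimum $k$ such that $H$ is $k$-choosable. *)

theory Defs
  imports Complex_Main
begin

definition hypergraph :: "'a set \<Rightarrow> 'a set set \<Rightarrow> bool" where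
  "hypergraph V E \<longleftrightarrow> finite V \<and> E \<subseteq> Pow V"

definition proper_coloring :: "'a set set \<Rightarrow> ('a \<Rightarrow> 'c) \<Rightarrow> bool" where
  "proper_coloring E c \<longleftrightarrow> (\<forall>e\<in>E. \<exists>u\<in>e. \<exists>v\<in>e. c u \<noteq> c v)"

definition colorable :: "'a set \<Rightarrow> 'a set set \<Rightarrow> nat \<Rightarrow> bool" where
  "colorable V E k \<longleftrightarrow> (\<exists>c :: 'a \<Rightarrow> nat. (\<forall>v\<in>V. c v < k) \<and> proper_coloring E c)"

text \<open>
  Colors are natural numbers. This is no restriction: on a finite vertex set, finite lists of size
  \<open>k\<close> involve only finitely many colors, which can be renamed injectively. Finiteness of the
  lists is required explicitly because \<^const>\<open>card\<close> is \<open>0\<close> on infinite sets.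
\<close>

definition choosable :: "'a set \<Rightarrow> 'a set set \<Rightarrow> nat \<Rightarrow> bool" where
  "choosable V E k \<longleftrightarrow>
    (\<forall>S :: 'a \<Rightarrow> nat set. (\<forall>v\<in>V. finite (S v) \<and> card (S v) = k) \<longrightarrow>
      (\<exists>c. (\<forall>v\<in>V. c v \<in> S v) \<and> proper_coloring E c))"

text \<open>
  The minimum exists whenever every edge has at least two vertices (for instance, when the
  hypergraph is 2-colorable): then the hypergraph is \<open>card V\<close>-choosable, by coloring all
  vertices differently. Otherwise it has no proper coloring, no \<open>k\<close> works, and the value is not meaningful.
\<close>

definition list_chromatic_number :: "'a set \<Rightarrow> 'a set set \<Rightarrow> nat" where
  "list_chromatic_number V E = (LEAST k. choosable V E k)"

definition max_density :: "'a set set \<Rightarrow> real" where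
  "max_density E = Max {real (card E') / real (card (\<Union>E')) | E'. E' \<noteq> {} \<and> E' \<subseteq> E}"

end

theory Submission
  imports Defs
begin

text \<open>
  Put \<open>d = \<lceil>L(H)\<rceil>\<close>. By Hall's theorem every edge \<open>e\<close> can be assigned a vertex of \<open>e\<close> such that
  no vertex is assigned to more than \<open>d\<close> edges. In a proper 2-coloring, \<open>e\<close> also contains a vertex of
  the colour opposite to that of the assigned one; draw an arc from the assigned vertex to it. This
  gives a bipartite digraph of outdegree at most \<open>d\<close> whose proper colorings are proper for \<open>H\<close>.
  Every induced subdigraph of a bipartite digraph has a kernel, so by the kernel method
  (Bondy, Boppana and Siegel; Galvin) lists of size \<open>d + 1\<close> suffice.
\<close>

text \<open>Induction on \<open>card I\<close>. If a nonempty proper subfamily \<open>J\<close> is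
  tight, it is matched inside its union and the remaining indices outside it. Otherwise every
  nonempty proper subfamily has a surplus, and one pair may be fixed arbitrarily.\<close>

lemma hall_marriage:
  fixes A :: "'i \<Rightarrow> 'a set"
  assumes "finite I" and "\<And>i. i \<in> I \<Longrightarrow> finite (A i)"
    and "\<And>J. J \<subseteq> I \<Longrightarrow> card J \<le> card (\<Union>(A ` J))"
  shows "\<exists>f. inj_on f I \<and> (\<forall>i\<in>I. f i \<in> A i)"
  using assms
proof (induction "card I" arbitrary: I A rule: less_induct)
  case less
  note fin = less.prems(1,2) and hall = less.prems(3)
  have finU: "finite (\<Union>(A ` J))" if "J \<subseteq> I" for J
    using finite_subset[OF that fin(1)] fin(2) that by blast
  show ?case
  proof (cases "\<exists>J. J \<subset> I \<and> J \<noteq> {} \<and> card (\<Union>(A ` J)) = card J")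
    case True
    then obtain J where J: "J \<subset> I" "J \<noteq> {}" "card (\<Union>(A ` J)) = card J" by blast
    define B where "B = \<Union>(A ` J)"
    have finJ: "finite J" using J fin(1) finite_subset by blast
    have "\<exists>f. inj_on f J \<and> (\<forall>i\<in>J. f i \<in> A i)"
    proof (rule less.hyps)
      show "card J < card I" using J fin(1) psubset_card_mono by blast
    qed (use J fin hall finJ in auto)
    then obtain f where f: "inj_on f J" "\<forall>i\<in>J. f i \<in> A i" by blast
    have "\<exists>g. inj_on g (I - J) \<and> (\<forall>i\<in>I - J. g i \<in> A i - B)"
    proof (rule less.hyps)
      show "card (I - J) < card I"
        using J fin(1) by (intro psubset_card_mono) auto
    next
      fix K assume K: "K \<subseteq> I - J"
      \<comment> \<open>Hall's condition survives the removal of \<open>B\<close>: apply the old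
        condition to \<open>K \<union> J\<close> and cancel \<open>card J = card B\<close>.\<close>
      have "card K + card J = card (K \<union> J)"
        using K finJ finite_subset[OF K] fin(1) by (subst card_Un_disjoint) auto
      also have "\<dots> \<le> card (\<Union>(A ` (K \<union> J)))"
        using K J by (intro hall) auto
      also have "\<Union>(A ` (K \<union> J)) = \<Union>((\<lambda>i. A i - B) ` K) \<union> B"
        by (auto simp: B_def)
      also have "card \<dots> \<le> card (\<Union>((\<lambda>i. A i - B) ` K)) + card B"
        by (rule card_Un_le)
      finally show "card K \<le> card (\<Union>((\<lambda>i. A i - B) ` K))"
        using J by (simp add: B_def)
    qed (use fin in auto)
    then obtain g where g: "inj_on g (I - J)" "\<forall>i\<in>I - J. g i \<in> A i - B" by blast
    have fB: "f i \<in> B" if "i \<in> J" for i using f that by (auto simp: B_def)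
    define h where "h = (\<lambda>i. if i \<in> J then f i else g i)"
    have "inj_on h I"
    proof (rule inj_onI)
      fix x y assume xy: "x \<in> I" "y \<in> I" "h x = h y"
      \<comment> \<open>Membership of the value in \<open>B\<close> reveals which of the two
        matchings was used, so they cannot collide.\<close>
      have "h z \<in> B \<longleftrightarrow> z \<in> J" if "z \<in> I" for z
        using that g(2) fB by (simp add: h_def)
      then have "x \<in> J \<longleftrightarrow> y \<in> J" using xy by metis
      then show "x = y"
        using xy inj_onD[OF f(1), of x y] inj_onD[OF g(1), of x y]
        by (cases "x \<in> J") (simp_all add: h_def)
    qed
    moreover have "\<forall>i\<in>I. h i \<in> A i" using f g by (auto simp: h_def)
    ultimately show ?thesis by blast
  next
    case False
    show ?thesis
    proof (cases "I = {}")
      case False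
      then obtain i where i: "i \<in> I" by blast
      have "card {i} \<le> card (\<Union>(A ` {i}))" using i by (intro hall) auto
      then obtain x where x: "x \<in> A i" by fastforce
      have "\<exists>g. inj_on g (I - {i}) \<and> (\<forall>j\<in>I - {i}. g j \<in> A j - {x})"
      proof (rule less.hyps)
        show "card (I - {i}) < card I" using i fin(1) by (intro psubset_card_mono) auto
      next
        fix K assume K: "K \<subseteq> I - {i}"
        show "card K \<le> card (\<Union>((\<lambda>j. A j - {x}) ` K))"
        proof (cases "K = {}")
          case False
          have "K \<subset> I" "K \<subseteq> I" using K i by auto
          \<comment> \<open>The surplus of at least one pays for the deletion of
            \<open>x\<close>.\<close>
          then have "card K < card (\<Union>(A ` K))"
            using hall[of K] False \<open>\<not> (\<exists>J. J \<subset> I \<and> J \<noteq> {} \<and> card (\<Union>(A ` J)) = card J)\<close>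
            by (metis le_neq_implies_less)
          also have "card (\<Union>(A ` K)) \<le> card (insert x (\<Union>((\<lambda>j. A j - {x}) ` K)))"
            using finU[OF \<open>K \<subseteq> I\<close>]
            by (intro card_mono finite.insertI) (erule rev_finite_subset, auto)
          also have "\<dots> \<le> Suc (card (\<Union>((\<lambda>j. A j - {x}) ` K)))"
            by (rule card_insert_le_m1[THEN order_trans]) auto
          finally show ?thesis by simp
        qed simp
      qed (use fin in auto)
      then obtain g where g: "inj_on g (I - {i})" "\<forall>j\<in>I - {i}. g j \<in> A j - {x}" by blast
      have "inj_on (g(i := x)) I \<and> (\<forall>j\<in>I. (g(i := x)) j \<in> A j)"
        using g x by (auto simp: inj_on_def)
      then show ?thesis by blast
    qed simp
  qed
qed

text \<open>The set \<open>K\<close> is a kernel of the digraph induced on \<open>U\<close>. A sink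
  \<open>s\<close> belongs to every kernel, so \<open>s\<close> and its in-neighbours are deleted
  and \<open>s\<close> is added to a kernel of the rest.\<close>

lemma bipartite_kernel:
  fixes P :: "'a \<Rightarrow> bool"
  assumes "finite U" and bip: "\<And>v w. (v, w) \<in> R \<Longrightarrow> P v \<noteq> P w"
  shows "\<exists>K\<subseteq>U. (\<forall>v\<in>K. \<forall>w\<in>K. (v, w) \<notin> R) \<and> (\<forall>v\<in>U - K. \<exists>w\<in>K. (v, w) \<in> R)"
  using assms(1)
proof (induction U rule: finite_psubset_induct)
  case (psubset U)
  show ?case
  proof (cases "\<exists>s\<in>U. \<forall>w\<in>U. (s, w) \<notin> R")
    case True
    then obtain s where s: "s \<in> U" "\<forall>w\<in>U. (s, w) \<notin> R" by blast
    define U' where "U' = {v \<in> U. v \<noteq> s \<and> (v, s) \<notin> R}"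
    have "U' \<subset> U" using s by (auto simp: U'_def)
    from psubset.IH[OF this] obtain K where K: "K \<subseteq> U'" "\<forall>v\<in>K. \<forall>w\<in>K. (v, w) \<notin> R"
      "\<forall>v\<in>U' - K. \<exists>w\<in>K. (v, w) \<in> R" by blast
    show ?thesis
      by (rule exI[of _ "insert s K"]) (use K s in \<open>auto simp: U'_def\<close>)
  next
    case False
    \<comment> \<open>Without sinks, either colour class is a kernel.\<close>
    show ?thesis
      by (rule exI[of _ "{v\<in>U. P v}"]) (use False bip in blast)
  qed
qed

text \<open>Kernel method: give a colour \<open>a\<close> to a kernel of the vertices whose lists
  contain \<open>a\<close>, remove \<open>a\<close> from the other lists and recurse. A vertex whose
  list shrinks also loses an out-neighbour, so the strict inequality is preserved. It also makes
  each list finite, since infinite sets have \<open>card\<close> 0.\<close>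

lemma bipartite_list_coloring:
  fixes P :: "'a \<Rightarrow> bool" and S :: "'a \<Rightarrow> 'c set"
  assumes "finite U" and bip: "\<And>v w. (v, w) \<in> R \<Longrightarrow> P v \<noteq> P w"
    and "\<And>v. v \<in> U \<Longrightarrow> card {w \<in> U. (v, w) \<in> R} < card (S v)"
  shows "\<exists>c. (\<forall>v\<in>U. c v \<in> S v) \<and> (\<forall>v\<in>U. \<forall>w\<in>U. (v, w) \<in> R \<longrightarrow> c v \<noteq> c w)"
  using assms(1,3)
proof (induction U arbitrary: S rule: finite_psubset_induct)
  case (psubset U)
  note out = psubset.prems
  show ?case
  proof (cases "U = {}")
    case False
    then obtain u where u: "u \<in> U" by blast
    then obtain a where a: "a \<in> S u" using out[OF u] by fastforce
    define W where "W = {v \<in> U. a \<in> S v}"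
    have "finite W" using psubset.hyps by (simp add: W_def)
    then have "\<exists>K\<subseteq>W. (\<forall>v\<in>K. \<forall>w\<in>K. (v, w) \<notin> R) \<and> (\<forall>v\<in>W - K. \<exists>w\<in>K. (v, w) \<in> R)"
      by (rule bipartite_kernel) (rule bip)
    then obtain K where K: "K \<subseteq> W" "\<forall>v\<in>K. \<forall>w\<in>K. (v, w) \<notin> R"
      "\<forall>v\<in>W - K. \<exists>w\<in>K. (v, w) \<in> R" by (elim exE conjE) (rule that)
    \<comment> \<open>As \<open>u\<close> lies in \<open>W\<close>, an empty \<open>K\<close> could
      not absorb it; hence the recursion is on a smaller set.\<close>
    have "K \<noteq> {}" using K(3) u a by (auto simp: W_def)
    then have "U - K \<subset> U" using K(1) by (auto simp: W_def)
    moreover have "card {w \<in> U - K. (v, w) \<in> R} < card (S v - {a})" if v: "v \<in> U - K" for v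
    proof (cases "v \<in> W")
      case True
      then obtain w where w: "w \<in> K" "(v, w) \<in> R" using K(3) v by blast
      have "{w \<in> U - K. (v, w) \<in> R} \<subset> {w \<in> U. (v, w) \<in> R}"
        using w K(1) by (auto simp: W_def)
      then have "card {w \<in> U - K. (v, w) \<in> R} < card {w \<in> U. (v, w) \<in> R}"
        using psubset.hyps by (intro psubset_card_mono) auto
      moreover have "card (S v - {a}) = card (S v) - 1"
        using True by (simp add: W_def)
      ultimately show ?thesis using out[of v] v by simp
    next
      case False
      then have "S v - {a} = S v" using v by (auto simp: W_def)
      moreover have "card {w \<in> U - K. (v, w) \<in> R} \<le> card {w \<in> U. (v, w) \<in> R}"
        using psubset.hyps by (intro card_mono) auto
      ultimately show ?thesis using out[of v] v by simp
    qed
    ultimately obtain c where c: "\<forall>v\<in>U - K. c v \<in> S v - {a}"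
      "\<forall>v\<in>U - K. \<forall>w\<in>U - K. (v, w) \<in> R \<longrightarrow> c v \<noteq> c w"
      using psubset.IH[of "U - K" "\<lambda>v. S v - {a}"] by blast
    show ?thesis
      by (rule exI[of _ "\<lambda>v. if v \<in> K then a else c v"])
        (use c K(1,2) in \<open>auto simp: W_def\<close>)
  qed simp
qed

lemma hypergraph_finite:
  assumes "hypergraph V E"
  shows "finite E" and "F \<subseteq> E \<Longrightarrow> finite (\<Union>F)"
proof -
  have V: "finite V" "E \<subseteq> Pow V" using assms by (simp_all add: hypergraph_def)
  show "finite E" by (rule finite_subset[OF V(2)]) (simp add: V(1))
  show "finite (\<Union>F)" if "F \<subseteq> E"
    by (rule finite_subset[OF _ V(1)]) (use that V(2) in blast)
qed

text \<open>This is Hall's condition for the edges when each vertex is available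
  \<lceil>L(H)\<rceil> times.\<close>

lemma card_le_max_density:
  assumes "hypergraph V E" and "{} \<notin> E" and "F \<subseteq> E"
  shows "card F \<le> nat \<lceil>max_density E\<rceil> * card (\<Union>F)"
proof (cases "F = {}")
  case False
  have "finite (\<Union>F)" using hypergraph_finite(2) assms(1,3) .
  \<comment> \<open>A zero denominator must be excluded: division by 0 yields 0 and would bound
    nothing.\<close>
  moreover have "\<Union>F \<noteq> {}" using False assms(2,3) by fastforce
  ultimately have pos: "0 < real (card (\<Union>F))" by (simp add: card_gt_0_iff)
  have "finite E" using hypergraph_finite(1) assms(1) .
  then have "finite {real (card E') / real (card (\<Union>E')) | E'. E' \<noteq> {} \<and> E' \<subseteq> E}"
    by simp
  then have "real (card F) / real (card (\<Union>F)) \<le> max_density E"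
    unfolding max_density_def by (rule Max_ge) (use False assms(3) in blast)
  also have "\<dots> \<le> real (nat \<lceil>max_density E\<rceil>)" by linarith
  finally have "real (card F) \<le> real (nat \<lceil>max_density E\<rceil>) * real (card (\<Union>F))"
    using pos by (simp add: divide_le_eq)
  then show ?thesis by (metis of_nat_le_iff of_nat_mult)
qed simp

lemma max_density_nonneg:
  assumes "hypergraph V E" and "E \<noteq> {}"
  shows "0 \<le> max_density E"
proof -
  have "finite E" using hypergraph_finite(1) assms(1) .
  then have "finite {real (card E') / real (card (\<Union>E')) | E'. E' \<noteq> {} \<and> E' \<subseteq> E}"
    by simp
  then have "real (card E) / real (card (\<Union>E)) \<le> max_density E"
    unfolding max_density_def by (rule Max_ge) (use assms(2) in blast)
  then show ?thesis by (rule order_trans[rotated]) simp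
qed

text \<open>Hall's theorem is applied to \<open>d\<close> labelled copies of each vertex. Forgetting
  the label gives \<open>f\<close>; edges sent to the same vertex have distinct labels, so there are
  at most \<open>d\<close> of them.\<close>

lemma bounded_edge_assignment:
  assumes "hypergraph V E" and "\<And>F. F \<subseteq> E \<Longrightarrow> card F \<le> d * card (\<Union>F)"
  shows "\<exists>f. \<forall>e\<in>E. f e \<in> e \<and> card {e' \<in> E. f e' = f e} \<le> d"
proof -
  have finE: "finite E" using hypergraph_finite(1) assms(1) .
  have fine: "finite e" if "e \<in> E" for e
    using hypergraph_finite(2)[OF assms(1), of "{e}"] that by simp
  have "\<exists>g. inj_on g E \<and> (\<forall>e\<in>E. g e \<in> e \<times> {..<d})"
  proof (rule hall_marriage)
    fix F assume "F \<subseteq> E"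
    moreover have "\<Union>((\<lambda>e. e \<times> {..<d}) ` F) = \<Union>F \<times> {..<d}" by auto
    ultimately show "card F \<le> card (\<Union>((\<lambda>e. e \<times> {..<d}) ` F))"
      using assms(2)[of F] by (simp add: card_cartesian_product mult.commute)
  qed (use finE fine in auto)
  then obtain g where g: "inj_on g E" "\<And>e. e \<in> E \<Longrightarrow> g e \<in> e \<times> {..<d}" by blast
  have "card {e' \<in> E. fst (g e') = v} \<le> d" for v
  proof -
    have "inj_on (snd \<circ> g) {e' \<in> E. fst (g e') = v}"
      using g(1) by (auto simp: inj_on_def prod_eq_iff)
    moreover have "(snd \<circ> g) ` {e' \<in> E. fst (g e') = v} \<subseteq> {..<d}"
      using g(2) by force
    ultimately have "card {e' \<in> E. fst (g e') = v} \<le> card {..<d}"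
      by (rule card_inj_on_le) simp
    then show ?thesis by simp
  qed
  then show ?thesis
    using g(2) by (intro exI[of _ "fst \<circ> g"]) (auto simp: mem_Times_iff)
qed

lemma choosable_if_edge_density_le:
  assumes "hypergraph V E" and "colorable V E 2"
    and "\<And>F. F \<subseteq> E \<Longrightarrow> card F \<le> d * card (\<Union>F)"
  shows "choosable V E (d + 1)"
  unfolding choosable_def
proof (intro allI impI)
  fix S :: "'a \<Rightarrow> nat set" assume S: "\<forall>v\<in>V. finite (S v) \<and> card (S v) = d + 1"
  have finV: "finite V" and EV: "E \<subseteq> Pow V"
    using assms(1) by (simp_all add: hypergraph_def)
  have finE: "finite E" using hypergraph_finite(1) assms(1) .
  obtain p :: "'a \<Rightarrow> nat" where p: "\<forall>v\<in>V. p v < 2" "proper_coloring E p"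
    using assms(2) by (auto simp: colorable_def)
  obtain f where f: "\<And>e. e \<in> E \<Longrightarrow> f e \<in> e"
    and fd: "\<And>e. e \<in> E \<Longrightarrow> card {e' \<in> E. f e' = f e} \<le> d"
    using bounded_edge_assignment[OF assms(1,3)] by blast
  have "\<exists>w. w \<in> e \<and> p w \<noteq> p (f e)" if "e \<in> E" for e
    using p(2) that unfolding proper_coloring_def by metis
  then obtain g where g: "\<And>e. e \<in> E \<Longrightarrow> g e \<in> e \<and> p (g e) \<noteq> p (f e)" by metis
  define R where "R = (\<lambda>e. (f e, g e)) ` E"
  have bip: "(p v = 0) \<noteq> (p w = 0)" if vw: "(v, w) \<in> R" for v w
  proof -
    obtain e where e: "e \<in> E" "v = f e" "w = g e" using vw by (auto simp: R_def)
    then have "v \<in> V" "w \<in> V" "p v \<noteq> p w" using f g EV by (blast, blast, metis)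
    \<comment> \<open>With values below 2, different colours mean that exactly one of them is
      0.\<close>
    then show ?thesis using p(1) by (metis less_2_cases)
  qed
  \<comment> \<open>The bound \<open>fd\<close> speaks only of vertices of the form
    \<open>f e\<close>; any other vertex has no outgoing arc.\<close>
  have out: "card {w \<in> V. (v, w) \<in> R} \<le> d" for v
  proof (cases "\<exists>e\<in>E. f e = v")
    case True
    have "{w \<in> V. (v, w) \<in> R} \<subseteq> g ` {e \<in> E. f e = v}" by (auto simp: R_def)
    then have "card {w \<in> V. (v, w) \<in> R} \<le> card {e \<in> E. f e = v}"
      using finE by (intro surj_card_le) auto
    then show ?thesis using True fd by force
  next
    case False
    then have "{w \<in> V. (v, w) \<in> R} = {}" by (auto simp: R_def)
    then show ?thesis by (simp only: card.empty)
  qed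
  \<comment> \<open>Lists of size \<open>d + 1\<close> exceed the outdegree bound by one, which
    gives the strict inequality required.\<close>
  obtain c where c: "\<forall>v\<in>V. c v \<in> S v" "\<forall>v\<in>V. \<forall>w\<in>V. (v, w) \<in> R \<longrightarrow> c v \<noteq> c w"
    using bipartite_list_coloring[of V R "\<lambda>v. p v = 0" S] finV bip out S
    by (simp add: less_Suc_eq_le) blast
  have "proper_coloring E c"
    unfolding proper_coloring_def
  proof
    fix e assume e: "e \<in> E"
    then have "f e \<in> V" "g e \<in> V" "(f e, g e) \<in> R" using f g EV by (auto simp: R_def)
    then show "\<exists>u\<in>e. \<exists>v\<in>e. c u \<noteq> c v" using c(2) f g e by blast
  qed
  with c(1) show "\<exists>c. (\<forall>v\<in>V. c v \<in> S v) \<and> proper_coloring E c" by blast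
qed

theorem theorem6:
  fixes V :: "'a set" and E :: "'a set set"
  assumes "hypergraph V E"
    and "colorable V E 2"
    and "E \<noteq> {}"
  shows "int (list_chromatic_number V E) \<le> \<lceil>max_density E\<rceil> + 1"
proof -
  have "{} \<notin> E" using assms(2) by (auto simp: colorable_def proper_coloring_def)
  then have "choosable V E (nat \<lceil>max_density E\<rceil> + 1)"
    using assms by (intro choosable_if_edge_density_le card_le_max_density)
  then have "list_chromatic_number V E \<le> nat \<lceil>max_density E\<rceil> + 1"
    unfolding list_chromatic_number_def by (rule Least_le)
  \<comment> \<open>Nonnegativity ensures that \<open>nat\<close> did not truncate the
    ceiling.\<close>
  moreover have "0 \<le> \<lceil>max_density E\<rceil>"
    using max_density_nonneg[OF assms(1,3)] by simp
  ultimately show ?thesis by linarith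
qed

end
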